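(* Let $R$ be a commutative ring with $1$ such that $\frac12\in R$, let $\mathcal{X}_R=\mathrm{Hom}(R,\mathbb{R})$ be nonempty, and assume the map $R\to C(\mathcal{X}_R)$, $a\mapsto\hat a$, is injective. For any compact set $K\subseteq\mathcal{X}_R$ and any integer $d\ge 1$, $$\overline{\sum R^{2d}}^{\,\|\cdot\|_K}=\mathrm{Psd}(K).$$
   Context: $\mathcal{X}_R=\mathrm{Hom}(R,\mathbb{R})$ is the set of unitary ring homomorphisms $\alpha:R\to\mathbb{R}$, with the subspace topology inherited from the product topology on $\mathbb{R}^R$. For $a\in R$, $\hat a:\mathcal{X}_R\to\mathbb{R}$ is $\hat a(\alpha)=\alpha(a)$. For $K$ compact, $\|a\|_K:=\sup_{\alpha\in K}|\alpha(a)|$ for $a\in R$, and the $\|\cdot\|_K$-topology on $R$ is the one whose neighborhoods of $a$ are generated by the balls $\{b\in R:\|a-b\|_K<\epsilon\}$, $\epsilon>0$ (not necessarily Hausdorff). $\sum R^{2d}$ is the set of finite sums of $2d$-th powers of elements of $R$. $\mathrm{Psd}(K):=\{a\in R:\alpha(a)\ge 0 \text{ for all }\alpha\in K\}$. The overline denotes closure in the indicated topology. *)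

theory Defs
  imports "HOL-Analysis.Analysis"
begin

text \<open>The ring is the universe of a type of class \<^class>\<open>comm_ring_1\<close>. That class requires
  \<open>0 \<noteq> 1\<close>, which is no restriction as soon as there is a unital homomorphism to the reals.\<close>

definition real_homs :: "('a::comm_ring_1 \<Rightarrow> real) set" where
  "real_homs = {\<alpha>. \<alpha> 1 = 1 \<and> (\<forall>a b. \<alpha> (a + b) = \<alpha> a + \<alpha> b) \<and> (\<forall>a b. \<alpha> (a * b) = \<alpha> a * \<alpha> b)}"

definition hom_topology :: "('a::comm_ring_1 \<Rightarrow> real) topology" where
  "hom_topology = subtopology (powertop_real UNIV) real_homs"

text \<open>The function \<open>hat a\<close> is restricted to \<^const>\<open>real_homs\<close> (and \<^const>\<open>undefined\<close> elsewhere), so that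
  \<open>hat a = hat b\<close> means equality as functions on \<^const>\<open>real_homs\<close>.\<close>

definition hat :: "'a::comm_ring_1 \<Rightarrow> ('a \<Rightarrow> real) \<Rightarrow> real" where
  "hat a = (\<lambda>\<alpha>\<in>real_homs. \<alpha> a)"

lemma topspace_hom_topology: "topspace hom_topology = real_homs"
  by (simp add: hom_topology_def)

lemma continuous_map_hat: "continuous_map hom_topology euclideanreal (hat a)"
proof -
  have "continuous_map hom_topology euclideanreal (\<lambda>\<alpha>. \<alpha> a)"
    unfolding hom_topology_def
    by (intro continuous_map_from_subtopology continuous_map_product_projection) simp
  then show ?thesis
    by (rule continuous_map_eq) (simp add: hat_def topspace_hom_topology)
qed

text \<open>The supremum is taken in the nonnegative reals, so it is \<open>0\<close> for empty \<open>K\<close>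
  (the supremum of the empty set of reals is unspecified in HOL).\<close>

definition sup_seminorm :: "('a::comm_ring_1 \<Rightarrow> real) set \<Rightarrow> 'a \<Rightarrow> real" where
  "sup_seminorm K a = (if K = {} then 0 else (SUP \<alpha>\<in>K. \<bar>\<alpha> a\<bar>))"

definition sup_seminorm_topology :: "('a::comm_ring_1 \<Rightarrow> real) set \<Rightarrow> 'a topology" where
  "sup_seminorm_topology K =
     topology (\<lambda>U. \<forall>a\<in>U. \<exists>\<epsilon>>0. {b. sup_seminorm K (a - b) < \<epsilon>} \<subseteq> U)"

lemma openin_sup_seminorm_topology:
  "openin (sup_seminorm_topology K) U \<longleftrightarrow>
     (\<forall>a\<in>U. \<exists>\<epsilon>>0. {b. sup_seminorm K (a - b) < \<epsilon>} \<subseteq> U)"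
proof -
  have "istopology (\<lambda>U. \<forall>a\<in>U. \<exists>\<epsilon>>0. {b. sup_seminorm K (a - b) < \<epsilon>} \<subseteq> U)"
    unfolding istopology_def
  proof (intro conjI allI impI ballI)
    fix S T :: "'a set" and a
    assume S: "\<forall>a\<in>S. \<exists>\<epsilon>>0. {b. sup_seminorm K (a - b) < \<epsilon>} \<subseteq> S"
      and T: "\<forall>a\<in>T. \<exists>\<epsilon>>0. {b. sup_seminorm K (a - b) < \<epsilon>} \<subseteq> T" and a: "a \<in> S \<inter> T"
    obtain e f where "e > 0" "{b. sup_seminorm K (a - b) < e} \<subseteq> S"
      "f > 0" "{b. sup_seminorm K (a - b) < f} \<subseteq> T"
      using S T a by (meson IntE)
    then show "\<exists>\<epsilon>>0. {b. sup_seminorm K (a - b) < \<epsilon>} \<subseteq> S \<inter> T"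
      by (intro exI[of _ "min e f"]) auto
  next
    fix \<K> :: "'a set set" and a
    assume "\<forall>S\<in>\<K>. \<forall>a\<in>S. \<exists>\<epsilon>>0. {b. sup_seminorm K (a - b) < \<epsilon>} \<subseteq> S" "a \<in> \<Union>\<K>"
    then show "\<exists>\<epsilon>>0. {b. sup_seminorm K (a - b) < \<epsilon>} \<subseteq> \<Union>\<K>"
      by (meson Union_iff Union_upper order_trans)
  qed
  then show ?thesis
    by (simp add: sup_seminorm_topology_def topology_inverse')
qed

definition sums_of_powers :: "nat \<Rightarrow> 'a::comm_ring_1 set" where
  "sums_of_powers n = {\<Sum>x\<leftarrow>xs. x ^ n | xs. True}"

definition Psd :: "('a::comm_ring_1 \<Rightarrow> real) set \<Rightarrow> 'a set" where
  "Psd K = {a. \<forall>\<alpha>\<in>K. \<alpha> a \<ge> 0}"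

end

theory Submission
  imports Defs
begin

text \<open>Because \<open>1/2 \<in> R\<close>, the functions induced on \<open>K\<close> by elements of \<open>R\<close> include the dyadic
  constants, so their uniform closure is a point-separating algebra over the reals; by
  Stone--Weierstrass it contains every continuous function on \<open>K\<close>. If \<open>a\<close> is nonnegative on \<open>K\<close>,
  approximate the continuous function \<open>root (2 * d) a\<close> by some \<open>b\<close>; then the single power
  \<open>b ^ (2 * d)\<close> is close to \<open>a\<close>.\<close>

section \<open>Separation axioms for function spaces\<close>

text \<open>Distinct functions differ at some coordinate, so open sets separating the two values
  there pull back to open cylinders separating the functions. The three instances below rest on
  this.\<close>

lemma open_vimage_coordinate:
  fixes W :: "'b::topological_space set"
  assumes "open W"
  shows "open ((\<lambda>f::'a \<Rightarrow> 'b. f i) -` W)"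
  using assms by (intro open_vimage continuous_on_product_coordinates)

text \<open>The library makes function types Hausdorff only through the metric on a countable domain.
  Its arities for the weaker separation classes have to be generalised first.\<close>

instance "fun" :: (type, t0_space) t0_space
proof
  fix x y :: "'a \<Rightarrow> 'b"
  assume "x \<noteq> y"
  then obtain i where "x i \<noteq> y i" by auto
  then obtain U where "open U" "\<not> (x i \<in> U \<longleftrightarrow> y i \<in> U)"
    using separation_t0 by blast
  then show "\<exists>U. open U \<and> \<not> (x \<in> U \<longleftrightarrow> y \<in> U)"
    by (intro exI[of _ "(\<lambda>f. f i) -` U"]) (auto intro: open_vimage_coordinate)
qed

instance "fun" :: (type, t1_space) t1_space
proof
  fix x y :: "'a \<Rightarrow> 'b"
  assume "x \<noteq> y"
  then obtain i where "x i \<noteq> y i" by auto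
  then obtain U where "open U" "x i \<in> U" "y i \<notin> U"
    using separation_t1 by blast
  then show "\<exists>U. open U \<and> x \<in> U \<and> y \<notin> U"
    by (intro exI[of _ "(\<lambda>f. f i) -` U"]) (auto intro: open_vimage_coordinate)
qed

instance "fun" :: (type, t2_space) t2_space
proof
  fix x y :: "'a \<Rightarrow> 'b"
  assume "x \<noteq> y"
  then obtain i where "x i \<noteq> y i" by auto
  then obtain U V where "open U" "open V" "x i \<in> U" "y i \<in> V" "U \<inter> V = {}"
    using hausdorff by metis
  then show "\<exists>U V. open U \<and> open V \<and> x \<in> U \<and> y \<in> V \<and> U \<inter> V = {}"
    by (intro exI[of _ "(\<lambda>f. f i) -` U"] exI[of _ "(\<lambda>f. f i) -` V"])
      (auto intro: open_vimage_coordinate)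
qed

section \<open>Ring homomorphisms to the reals and compact sets of them\<close>

lemma
  assumes "\<alpha> \<in> real_homs"
  shows real_hom_1: "\<alpha> 1 = 1"
    and real_hom_add: "\<alpha> (a + b) = \<alpha> a + \<alpha> b"
    and real_hom_mult: "\<alpha> (a * b) = \<alpha> a * \<alpha> b"
  using assms by (auto simp: real_homs_def)

lemma real_hom_0: "\<alpha> \<in> real_homs \<Longrightarrow> \<alpha> 0 = 0"
  using real_hom_add[of \<alpha> 0 0] by simp

lemma real_hom_diff: "\<alpha> \<in> real_homs \<Longrightarrow> \<alpha> (a - b) = \<alpha> a - \<alpha> b"
  using real_hom_add[of \<alpha> "a - b" b] by simp

lemma real_hom_power: "\<alpha> \<in> real_homs \<Longrightarrow> \<alpha> (a ^ n) = \<alpha> a ^ n"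
  by (induction n) (simp_all add: real_hom_1 real_hom_mult)

lemma real_hom_of_nat: "\<alpha> \<in> real_homs \<Longrightarrow> \<alpha> (of_nat n) = of_nat n"
  by (induction n) (simp_all add: real_hom_0 real_hom_1 real_hom_add)

lemma real_hom_of_int: "\<alpha> \<in> real_homs \<Longrightarrow> \<alpha> (of_int k) = of_int k"
  by (cases k rule: int_diff_cases) (simp add: real_hom_diff real_hom_of_nat)

lemma real_hom_sum_list: "\<alpha> \<in> real_homs \<Longrightarrow> \<alpha> (\<Sum>x\<leftarrow>xs. f x) = (\<Sum>x\<leftarrow>xs. \<alpha> (f x))"
  by (induction xs) (simp_all add: real_hom_0 real_hom_add)

text \<open>The type-class topology on functions is the product topology, so compactness in the
  abstract topology turns into \<open>compact\<close>, the form that Stone--Weierstrass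
  takes.\<close>

lemma compactin_hom_topology:
  "compactin hom_topology K \<longleftrightarrow> compact K \<and> K \<subseteq> real_homs"
  by (simp add: hom_topology_def compactin_subtopology euclidean_product_topology)

section \<open>Uniform approximation on a compact set of homomorphisms\<close>

text \<open>Every homomorphism sends \<open>h\<close> to 1/2, so a dyadic rational has the same
  value under all of them; truncating \<open>c\<close> to \<open>k\<close> binary digits costs at
  most \<open>(1/2) ^ k\<close>.\<close>

lemma half_approximates_real:
  fixes h :: "'a::comm_ring_1" and c :: real
  assumes h: "1 = 2 * h" and "e > 0"
  shows "\<exists>a::'a. \<forall>\<alpha>\<in>real_homs. \<bar>c - \<alpha> a\<bar> < e"
proof -
  obtain k where k: "(1/2) ^ k < e"
    using real_arch_pow_inv[of e "1/2"] \<open>e > 0\<close> by auto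
  define a :: 'a where "a = of_int \<lfloor>c * 2 ^ k\<rfloor> * h ^ k"
  have "\<bar>c - \<alpha> a\<bar> < e" if \<alpha>: "\<alpha> \<in> real_homs" for \<alpha>
  proof -
    \<comment> \<open>Writing 2 as \<open>of_int 2\<close> lets \<open>real_hom_of_int\<close>
      evaluate it.\<close>
    have "\<alpha> 1 = \<alpha> (of_int 2) * \<alpha> h"
      using h by (simp flip: real_hom_mult[OF \<alpha>])
    then have "\<alpha> h = 1/2"
      using \<alpha> by (simp only: real_hom_of_int real_hom_1)
    then have "\<alpha> a = of_int \<lfloor>c * 2 ^ k\<rfloor> * (1/2) ^ k"
      using \<alpha> by (simp only: a_def real_hom_mult real_hom_power real_hom_of_int)
    then have "c - \<alpha> a = (c * 2 ^ k - of_int \<lfloor>c * 2 ^ k\<rfloor>) * (1/2) ^ k"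
      by (simp add: field_simps)
    also have "\<bar>\<dots>\<bar> \<le> 1 * (1/2) ^ k"
      unfolding abs_mult
    proof (intro mult_mono)
      show "\<bar>c * 2 ^ k - of_int \<lfloor>c * 2 ^ k\<rfloor>\<bar> \<le> 1" by linarith
    qed simp_all
    finally show ?thesis using k by simp
  qed
  then show ?thesis by blast
qed

lemma compact_continuous_bounded_real:
  fixes f :: "'b::topological_space \<Rightarrow> real"
  assumes "compact K" "continuous_on K f"
  obtains M where "M > 0" "\<And>x. x \<in> K \<Longrightarrow> \<bar>f x\<bar> \<le> M"
  using compact_imp_bounded[OF compact_continuous_image[OF assms(2,1)]]
  by (auto simp: bounded_pos)

text \<open>Stone--Weierstrass puts \<open>g\<close> within \<open>e/2\<close> of a uniform limit of
  evaluations, which is itself within \<open>e/2\<close> of a single evaluation.\<close>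

lemma real_homs_dense:
  fixes K :: "('a::comm_ring_1 \<Rightarrow> real) set"
  assumes half: "(2::'a) dvd 1" and K: "compact K" "K \<subseteq> real_homs"
    and g: "continuous_on K g" and e: "e > 0"
  shows "\<exists>a. \<forall>\<alpha>\<in>K. \<bar>g \<alpha> - \<alpha> a\<bar> < e"
proof -
  obtain h :: 'a where h: "1 = 2 * h" using half by (rule dvdE)
  \<comment> \<open>Evaluations alone form a ring of functions that may miss some real constants;
    their uniform closure on \<open>K\<close> contains them all.\<close>
  define A where "A = {f. continuous_on K f \<and> (\<forall>e>0. \<exists>a. \<forall>\<alpha>\<in>K. \<bar>f \<alpha> - \<alpha> a\<bar> < e)}"
  have A_approx: "\<exists>a. \<forall>\<alpha>\<in>K. \<bar>f \<alpha> - \<alpha> a\<bar> < e" if "f \<in> A" "e > 0" for f e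
    using that by (simp add: A_def)
  \<comment> \<open>The locale needs its points in a \<open>t2_space\<close>; here the points are
    functions, so the instances above apply.\<close>
  interpret function_ring_on A K
  proof
    show "compact K" by fact
  next
    fix f assume "f \<in> A" then show "continuous_on K f" by (simp add: A_def)
  next
    fix f g assume fg: "f \<in> A" "g \<in> A"
    show "(\<lambda>x. f x + g x) \<in> A"
      unfolding A_def
    proof (intro CollectI conjI allI impI)
      show "continuous_on K (\<lambda>x. f x + g x)"
        using fg by (auto simp: A_def intro: continuous_intros)
      fix e :: real assume "e > 0"
      then obtain a where a: "\<forall>\<alpha>\<in>K. \<bar>f \<alpha> - \<alpha> a\<bar> < e/2"
        using A_approx[OF fg(1), of "e/2"] by auto
      obtain b where b: "\<forall>\<alpha>\<in>K. \<bar>g \<alpha> - \<alpha> b\<bar> < e/2"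
        using A_approx[OF fg(2), of "e/2"] \<open>e > 0\<close> by auto
      have "\<bar>f \<alpha> + g \<alpha> - \<alpha> (a + b)\<bar> < e" if \<alpha>: "\<alpha> \<in> K" for \<alpha>
      proof -
        have "\<alpha> (a + b) = \<alpha> a + \<alpha> b" "\<bar>f \<alpha> - \<alpha> a\<bar> < e/2" "\<bar>g \<alpha> - \<alpha> b\<bar> < e/2"
          using a b K(2) \<alpha> by (auto intro: real_hom_add)
        then show ?thesis by linarith
      qed
      then show "\<exists>a. \<forall>\<alpha>\<in>K. \<bar>f \<alpha> + g \<alpha> - \<alpha> a\<bar> < e" by blast
    qed
    show "(\<lambda>x. f x * g x) \<in> A"
      unfolding A_def
    proof (intro CollectI conjI allI impI)
      show "continuous_on K (\<lambda>x. f x * g x)"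
        using fg by (auto simp: A_def intro: continuous_intros)
      fix e :: real assume "e > 0"
      \<comment> \<open>The order of choices matters: \<open>b\<close> depends on the bound
        \<open>M\<close> of \<open>f\<close>, and \<open>a\<close> on the bound \<open>N\<close> of
        the evaluation at \<open>b\<close>. Each of the two error terms below is then less than
        \<open>e/2\<close>.\<close>
      obtain M where M: "M > 0" "\<And>x. x \<in> K \<Longrightarrow> \<bar>f x\<bar> \<le> M"
        using compact_continuous_bounded_real[of K f] K(1) fg(1) by (auto simp: A_def)
      obtain b where b: "\<forall>\<alpha>\<in>K. \<bar>g \<alpha> - \<alpha> b\<bar> < e / (2 * M)"
        using A_approx[OF fg(2), of "e / (2 * M)"] \<open>e > 0\<close> M(1) by auto
      obtain N where N: "N > 0" "\<And>\<alpha>. \<alpha> \<in> K \<Longrightarrow> \<bar>\<alpha> b\<bar> \<le> N"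
        using compact_continuous_bounded_real[of K "\<lambda>\<alpha>. \<alpha> b"] K(1)
        by (metis continuous_on_product_coordinates continuous_on_subset subset_UNIV)
      obtain a where a: "\<forall>\<alpha>\<in>K. \<bar>f \<alpha> - \<alpha> a\<bar> < e / (2 * N)"
        using A_approx[OF fg(1), of "e / (2 * N)"] \<open>e > 0\<close> N(1) by auto
      have "\<bar>f \<alpha> * g \<alpha> - \<alpha> (a * b)\<bar> < e" if \<alpha>: "\<alpha> \<in> K" for \<alpha>
      proof -
        have "f \<alpha> * g \<alpha> - \<alpha> (a * b) = f \<alpha> * (g \<alpha> - \<alpha> b) + \<alpha> b * (f \<alpha> - \<alpha> a)"
          using K(2) \<alpha> by (subst real_hom_mult) (auto simp: algebra_simps)
        also have "\<bar>\<dots>\<bar> \<le> \<bar>f \<alpha>\<bar> * \<bar>g \<alpha> - \<alpha> b\<bar> + \<bar>\<alpha> b\<bar> * \<bar>f \<alpha> - \<alpha> a\<bar>"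
          using abs_triangle_ineq by (simp flip: abs_mult)
        also have "\<dots> \<le> M * \<bar>g \<alpha> - \<alpha> b\<bar> + N * \<bar>f \<alpha> - \<alpha> a\<bar>"
          using M N \<alpha> by (intro add_mono mult_right_mono) auto
        also have "\<dots> < M * (e / (2 * M)) + N * (e / (2 * N))"
          using M N a b \<alpha> by (intro add_strict_mono mult_strict_left_mono) auto
        finally show ?thesis using M N by simp
      qed
      then show "\<exists>a. \<forall>\<alpha>\<in>K. \<bar>f \<alpha> * g \<alpha> - \<alpha> a\<bar> < e" by blast
    qed
  next
    fix c :: real
    have "\<exists>a. \<forall>\<alpha>\<in>K. \<bar>c - \<alpha> a\<bar> < e" if "e > 0" for e
      using half_approximates_real[OF h that, of c] K(2) by blast
    then show "(\<lambda>_. c) \<in> A"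
      by (simp add: A_def)
  next
    fix x y :: "'a \<Rightarrow> real" assume "x \<noteq> y"
    then obtain a where "x a \<noteq> y a" by auto
    \<comment> \<open>An evaluation is approximated by itself with error 0.\<close>
    moreover have "(\<lambda>\<alpha>. \<alpha> a) \<in> A"
      unfolding A_def
      by (auto intro: continuous_on_subset[OF continuous_on_product_coordinates] exI[of _ a])
    ultimately show "\<exists>f\<in>A. f x \<noteq> f y" by (intro bexI[of _ "\<lambda>\<alpha>. \<alpha> a"])
  qed
  obtain f where f: "f \<in> A" "\<forall>\<alpha>\<in>K. \<bar>g \<alpha> - f \<alpha>\<bar> < e/2"
    using Stone_Weierstrass_basic[OF g, of "e/2"] e by auto
  obtain a where a: "\<forall>\<alpha>\<in>K. \<bar>f \<alpha> - \<alpha> a\<bar> < e/2"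
    using A_approx[OF f(1), of "e/2"] e by auto
  have "\<bar>g \<alpha> - \<alpha> a\<bar> < e" if "\<alpha> \<in> K" for \<alpha>
    using f(2)[rule_format, OF that] a[rule_format, OF that] by linarith
  then show ?thesis by blast
qed

text \<open>The map \<open>x ^ n\<close> is uniformly continuous on bounded intervals, so a uniform
  approximation of the \<open>n\<close>-th root becomes one of \<open>a\<close> after taking
  powers.\<close>

lemma Psd_approx_power:
  fixes K :: "('a::comm_ring_1 \<Rightarrow> real) set"
  assumes half: "(2::'a) dvd 1" and K: "compact K" "K \<subseteq> real_homs"
    and a: "a \<in> Psd K" and n: "n > 0" and e: "e > 0"
  shows "\<exists>b. \<forall>\<alpha>\<in>K. \<bar>\<alpha> a - \<alpha> b ^ n\<bar> < e"
proof -
  define g where "g = (\<lambda>\<alpha>::'a \<Rightarrow> real. root n (\<alpha> a))"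
  have g: "continuous_on K g" unfolding g_def
    by (intro continuous_on_real_root continuous_on_subset[OF continuous_on_product_coordinates]) simp
  obtain M where M: "M > 0" "\<And>\<alpha>. \<alpha> \<in> K \<Longrightarrow> \<bar>g \<alpha>\<bar> \<le> M"
    using compact_continuous_bounded_real[OF K(1) g] by auto
  \<comment> \<open>The margin 1 beyond \<open>M\<close> leaves room for \<open>\<alpha> b\<close>,
    which is chosen within 1 of \<open>g \<alpha>\<close>.\<close>
  have "uniformly_continuous_on {- (M+1)..M+1} (\<lambda>x::real. x ^ n)"
    by (intro compact_uniformly_continuous continuous_intros) simp
  then obtain \<delta> where \<delta>: "\<delta> > 0" "\<And>x y. x \<in> {- (M+1)..M+1} \<Longrightarrow> y \<in> {- (M+1)..M+1} \<Longrightarrow>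
      \<bar>y - x\<bar> < \<delta> \<Longrightarrow> \<bar>y ^ n - x ^ n\<bar> < e"
    unfolding uniformly_continuous_on_def dist_real_def using e by metis
  obtain b where b: "\<forall>\<alpha>\<in>K. \<bar>g \<alpha> - \<alpha> b\<bar> < min \<delta> 1"
    using real_homs_dense[OF half K g, of "min \<delta> 1"] \<delta>(1) by auto
  have "\<bar>\<alpha> a - \<alpha> b ^ n\<bar> < e" if \<alpha>: "\<alpha> \<in> K" for \<alpha>
  proof -
    have "\<bar>g \<alpha>\<bar> \<le> M" "\<bar>g \<alpha> - \<alpha> b\<bar> < \<delta>" "\<bar>g \<alpha> - \<alpha> b\<bar> < 1"
      using M(2) b \<alpha> by auto
    then have "\<bar>g \<alpha> ^ n - \<alpha> b ^ n\<bar> < e"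
      by (intro \<delta>(2)) (auto simp: abs_le_iff abs_less_iff)
    \<comment> \<open>Nonnegativity of \<open>a\<close> on \<open>K\<close> enters here: the power
      undoes the root.\<close>
    moreover have "g \<alpha> ^ n = \<alpha> a"
      using a \<alpha> n by (simp add: g_def Psd_def)
    ultimately show ?thesis by simp
  qed
  then show ?thesis by blast
qed

section \<open>The supremum seminorm and its topology\<close>

text \<open>The condition \<open>e \<ge> 0\<close> covers empty \<open>K\<close>, where the seminorm
  is 0.\<close>

lemma sup_seminorm_le:
  assumes "\<And>\<alpha>. \<alpha> \<in> K \<Longrightarrow> \<bar>\<alpha> a\<bar> \<le> e" "e \<ge> 0"
  shows "sup_seminorm K a \<le> e"
  using assms by (auto simp: sup_seminorm_def intro: cSUP_least)

text \<open>Compactness bounds the values at \<open>a\<close>, so the supremum is a genuine upper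
  bound.\<close>

lemma le_sup_seminorm:
  fixes K :: "('a::comm_ring_1 \<Rightarrow> real) set"
  assumes "compact K" "\<alpha> \<in> K"
  shows "\<bar>\<alpha> a\<bar> \<le> sup_seminorm K a"
proof -
  have "continuous_on K (\<lambda>\<alpha>::'a \<Rightarrow> real. \<alpha> a)"
    by (rule continuous_on_subset[OF continuous_on_product_coordinates]) simp
  then obtain M where "\<And>\<alpha>. \<alpha> \<in> K \<Longrightarrow> \<bar>\<alpha> a\<bar> \<le> M"
    using compact_continuous_bounded_real[OF assms(1)] by metis
  then have "bdd_above ((\<lambda>\<alpha>. \<bar>\<alpha> a\<bar>) ` K)" by (rule bdd_aboveI2)
  then have "\<bar>\<alpha> a\<bar> \<le> (SUP \<alpha>\<in>K. \<bar>\<alpha> a\<bar>)" by (rule cSUP_upper[OF assms(2)])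
  with assms(2) show ?thesis by (auto simp: sup_seminorm_def)
qed

lemma topspace_sup_seminorm_topology: "topspace (sup_seminorm_topology K) = UNIV"
proof -
  have "openin (sup_seminorm_topology K) UNIV"
    unfolding openin_sup_seminorm_topology using zero_less_one by blast
  then show ?thesis using openin_subset by blast
qed

section \<open>The closure of the sums of even powers\<close>

text \<open>If \<open>\<alpha> a < 0\<close> for some \<open>\<alpha>\<close> in \<open>K\<close>,
  then every \<open>b\<close> in the ball of radius \<open>- \<alpha> a\<close> around
  \<open>a\<close> still has \<open>\<alpha> b < 0\<close>.\<close>

lemma closedin_Psd:
  assumes K: "compact K" "K \<subseteq> real_homs"
  shows "closedin (sup_seminorm_topology K) (Psd K)"
  unfolding closedin_def topspace_sup_seminorm_topology openin_sup_seminorm_topology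
proof (intro conjI subset_UNIV ballI)
  fix a assume "a \<in> UNIV - Psd K"
  then obtain \<alpha> where \<alpha>: "\<alpha> \<in> K" "\<alpha> a < 0" by (auto simp: Psd_def not_le)
  have "b \<notin> Psd K" if "sup_seminorm K (a - b) < - \<alpha> a" for b
  proof -
    have "\<bar>\<alpha> (a - b)\<bar> < - \<alpha> a"
      using le_sup_seminorm[OF K(1) \<alpha>(1)] that by (rule le_less_trans)
    then have "\<alpha> b < 0"
      using K(2) \<alpha>(1) by (simp add: real_hom_diff subset_iff)
    with \<alpha>(1) show ?thesis by (auto simp: Psd_def not_le)
  qed
  with \<alpha>(2) show "\<exists>\<epsilon>>0. {b. sup_seminorm K (a - b) < \<epsilon>} \<subseteq> UNIV - Psd K"
    by (intro exI[of _ "- \<alpha> a"]) auto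
qed

lemma sums_of_even_powers_subset_Psd:
  assumes "K \<subseteq> real_homs"
  shows "sums_of_powers (2 * d) \<subseteq> Psd K"
  using assms
  by (auto simp: sums_of_powers_def Psd_def subset_iff real_hom_sum_list real_hom_power
      intro!: sum_list_nonneg)

lemma power_in_sums_of_powers: "x ^ n \<in> sums_of_powers n"
  unfolding sums_of_powers_def by (auto intro!: exI[of _ "[x]"])

theorem theorem4p2:
  fixes K :: "('a::comm_ring_1 \<Rightarrow> real) set" and d :: nat
  assumes "(2::'a) dvd 1"
    and "(real_homs :: ('a \<Rightarrow> real) set) \<noteq> {}"
    and "inj (hat :: 'a \<Rightarrow> ('a \<Rightarrow> real) \<Rightarrow> real)"
    and "compactin hom_topology K"
    and "d \<ge> 1"
  shows "sup_seminorm_topology K closure_of sums_of_powers (2 * d) = Psd K"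
proof
  have K: "compact K" "K \<subseteq> real_homs"
    using assms(4) by (auto simp: compactin_hom_topology)
  show "sup_seminorm_topology K closure_of sums_of_powers (2 * d) \<subseteq> Psd K"
    using sums_of_even_powers_subset_Psd[OF K(2)] closedin_Psd[OF K]
    by (rule closure_of_minimal)
  show "Psd K \<subseteq> sup_seminorm_topology K closure_of sums_of_powers (2 * d)"
  proof
    fix a assume a: "a \<in> Psd K"
    have "\<exists>b\<in>sums_of_powers (2 * d). b \<in> U"
      if "openin (sup_seminorm_topology K) U" "a \<in> U" for U
    proof -
      obtain e where e: "e > 0" "{b. sup_seminorm K (a - b) < e} \<subseteq> U"
        using \<open>openin _ U\<close> \<open>a \<in> U\<close> unfolding openin_sup_seminorm_topology by blast
      \<comment> \<open>Pointwise strict bounds only give a weak bound on the supremum;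
        \<open>e/2\<close> keeps it strictly below \<open>e\<close>.\<close>
      obtain b where b: "\<forall>\<alpha>\<in>K. \<bar>\<alpha> a - \<alpha> b ^ (2 * d)\<bar> < e/2"
        using Psd_approx_power[OF assms(1) K a, of "2 * d" "e/2"] e(1) assms(5) by auto
      have "sup_seminorm K (a - b ^ (2 * d)) \<le> e/2"
        using b K(2) e(1)
        by (intro sup_seminorm_le) (auto simp: subset_iff real_hom_diff real_hom_power less_imp_le)
      with e have "b ^ (2 * d) \<in> U" by auto
      then show ?thesis using power_in_sums_of_powers by blast
    qed
    then show "a \<in> sup_seminorm_topology K closure_of sums_of_powers (2 * d)"
      by (auto simp: in_closure_of topspace_sup_seminorm_topology)
  qed
qed

end
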